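(* Let $S\subseteq V^{\setminus i}$ and $j_S\in\mathcal{D}_u^{S}$. Then $$\mathrm{LLBDeu}(S,j_S)\le f(S,j_S)+\underline{g}(S,j_S),\qquad \underline{g}(S,j_S)=\min_{j\in\mathcal{D}_u^{V^{\setminus i}}:\ j^{S}=j_S} g\big(V^{\setminus i},\,j,\,\alpha_{\mathrm{ess}}/q(S)\big).$$ Moreover, if $\mathrm{LBDeu}(S')\ \ge\ \underline{g}(S):=f(S)+\sum_{j_S\in\mathcal{D}_u^{S}}\underline{g}(S,j_S)$ for some proper subset $S'\subset S$, then no $T$ with $S\subseteq T\subseteq V^{\setminus i}$ belongs to $\mathcal{L}_i$.
   Context: Let $V=\{1,\dots,n\}$ index discrete random variables, fix a child variable $i\in V$ and put $V^{\setminus i}=V\setminus\{i\}$. Each variable $v$ has a finite nonempty state space $c(v)$; for $S\subseteq V$, $c(S)=\prod_{v\in S}c(v)$ (a singleton if $S=\emptyset$) and $q(S)=|c(S)|$; $q(i)=|c(i)|$. For $j\in c(S')$ and $S\subseteq S'$, $j^{S}\in c(S)$ is the projection of $j$. The data $\mathcal{D}$ is a finite multiset of elements of $c(V)$; $\mathcal{D}^{S}$ is the multiset of projections onto $S$, and $\mathcal{D}_u^{S}$ is the set of distinct elements of $\mathcal{D}^{S}$. For $S\subseteq V^{\setminus i}$ and $j\in c(S)$, $\mathcal{D}_u^{S\cup\{i\}}(j)$ is the set of elements of $\mathcal{D}_u^{S\cup\{i\}}$ whose projection onto $S$ is $j$; $n_j$ is the number of occurrences of $j$ in $\mathcal{D}^{S}$,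 and for $k\in c(i)$, $n_{j,k}$ is the number of elements of $\mathcal{D}^{S\cup\{i\}}$ (with multiplicity) with $S$-part $j$ and $i$-part $k$, so $n_j=\sum_k n_{j,k}$. Fix $\alpha_{\mathrm{ess}}>0$. For $j\in c(S)$, $\alpha_j=\alpha_{\mathrm{ess}}/q(S)$ and $\alpha_{j,k}=\alpha_{\mathrm{ess}}/(q(S)q(i))$. With $\Gamma_\alpha(x)=\Gamma(x+\alpha)/\Gamma(\alpha)$, $$\mathrm{LLBDeu}(S,j)=-\log\Gamma_{\alpha_j}(n_j)+\sum_{k\in c(i)}\log\Gamma_{\alpha_{j,k}}(n_{j,k}),\qquad \mathrm{LBDeu}(S)=\sum_{j\in\mathcal{D}_u^{S}}\mathrm{LLBDeu}(S,j).$$ $\mathcal{L}_i=\{S\subseteq V^{\setminus i}:\ \mathrm{LBDeu}(S')<\mathrm{LBDeu}(S)\text{ for every proper subset }S'\subset S\}$. For $S\subseteq V^{\setminus i}$ and $j\in\mathcal{D}_u^{S}$: $f(S,j)=-|\mathcal{D}_u^{S\cup\{i\}}(j)|\log q(i)$ and $f(S)=\sum_{j\in\mathcal{D}_u^{S}}f(S,j)$. For $\alpha>0$, $g(S,j,\alpha)=-\sum_{l=1}^{k'-1}\log(1+n_{j,l}/\alpha)$, where the counts $(n_{j,k})_{k\in c(i)}$ are listed in non-increasing order as $n_{j,1}\ge\dots\ge n_{j,q(i)}$ and $k'$ is the largest index with $n_{j,k'}>0$. *)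

theory Defs
  imports "HOL-Analysis.Gamma_Function" "HOL-Library.FuncSet" "HOL-Library.Multiset"
begin

text \<open>
  Variables are natural numbers and the state space of variable \<open>v\<close> is the set \<open>c v\<close>.
  An element of \<open>c(S)\<close> is an extensional function in \<open>PiE S c\<close>, so that it is determined by its
  values on \<open>S\<close>, \<open>c({})\<close> is a singleton, and projection onto \<open>S\<close> is \<open>restrict\<close> to \<open>S\<close>.
  Throughout, \<open>i\<close> is the child variable, \<open>D\<close> the data and \<open>a\<close> the equivalent sample size.
\<close>

definition configs :: "(nat \<Rightarrow> 'a set) \<Rightarrow> nat set \<Rightarrow> (nat \<Rightarrow> 'a) set" where
  "configs c S = PiE S c"

definition q :: "(nat \<Rightarrow> 'a set) \<Rightarrow> nat set \<Rightarrow> nat" where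
  "q c S = card (configs c S)"

definition proj_data :: "(nat \<Rightarrow> 'a) multiset \<Rightarrow> nat set \<Rightarrow> (nat \<Rightarrow> 'a) multiset" where
  "proj_data D S = image_mset (\<lambda>x. restrict x S) D"

definition distinct_data :: "(nat \<Rightarrow> 'a) multiset \<Rightarrow> nat set \<Rightarrow> (nat \<Rightarrow> 'a) set" where
  "distinct_data D S = set_mset (proj_data D S)"

text \<open>The set \<open>D\<^sub>u\<^bsup>S \<union> {i}\<^esup>(j)\<close>.\<close>

definition distinct_ext :: "nat \<Rightarrow> (nat \<Rightarrow> 'a) multiset \<Rightarrow> nat set \<Rightarrow> (nat \<Rightarrow> 'a) \<Rightarrow> (nat \<Rightarrow> 'a) set" where
  "distinct_ext i D S j = {x \<in> distinct_data D (S \<union> {i}). restrict x S = j}"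

definition n_par :: "(nat \<Rightarrow> 'a) multiset \<Rightarrow> nat set \<Rightarrow> (nat \<Rightarrow> 'a) \<Rightarrow> nat" where
  "n_par D S j = count (proj_data D S) j"

definition n_fam :: "nat \<Rightarrow> (nat \<Rightarrow> 'a) multiset \<Rightarrow> nat set \<Rightarrow> (nat \<Rightarrow> 'a) \<Rightarrow> 'a \<Rightarrow> nat" where
  "n_fam i D S j k = size {#x \<in># proj_data D (S \<union> {i}). restrict x S = j \<and> x i = k#}"

definition Gamma_ratio :: "real \<Rightarrow> real \<Rightarrow> real" where
  "Gamma_ratio b x = Gamma (x + b) / Gamma b"

definition alpha_par :: "(nat \<Rightarrow> 'a set) \<Rightarrow> real \<Rightarrow> nat set \<Rightarrow> real" where
  "alpha_par c a S = a / real (q c S)"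

definition alpha_fam :: "nat \<Rightarrow> (nat \<Rightarrow> 'a set) \<Rightarrow> real \<Rightarrow> nat set \<Rightarrow> real" where
  "alpha_fam i c a S = a / (real (q c S) * real (card (c i)))"

definition LLBDeu ::
  "nat \<Rightarrow> (nat \<Rightarrow> 'a set) \<Rightarrow> (nat \<Rightarrow> 'a) multiset \<Rightarrow> real \<Rightarrow> nat set \<Rightarrow> (nat \<Rightarrow> 'a) \<Rightarrow> real" where
  "LLBDeu i c D a S j =
     - ln (Gamma_ratio (alpha_par c a S) (real (n_par D S j)))
     + (\<Sum>k\<in>c i. ln (Gamma_ratio (alpha_fam i c a S) (real (n_fam i D S j k))))"

definition LBDeu ::
  "nat \<Rightarrow> (nat \<Rightarrow> 'a set) \<Rightarrow> (nat \<Rightarrow> 'a) multiset \<Rightarrow> real \<Rightarrow> nat set \<Rightarrow> real" where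
  "LBDeu i c D a S = (\<Sum>j\<in>distinct_data D S. LLBDeu i c D a S j)"

text \<open>The collection \<open>\<L>\<^sub>i\<close> of parent sets that score strictly better than all their proper
  subsets; \<open>V\<close> is the set of all variables.\<close>

definition candidate_parents ::
  "nat set \<Rightarrow> nat \<Rightarrow> (nat \<Rightarrow> 'a set) \<Rightarrow> (nat \<Rightarrow> 'a) multiset \<Rightarrow> real \<Rightarrow> nat set set" where
  "candidate_parents V i c D a =
     {S. S \<subseteq> V - {i} \<and> (\<forall>S'. S' \<subset> S \<longrightarrow> LBDeu i c D a S' < LBDeu i c D a S)}"

definition f_loc ::
  "nat \<Rightarrow> (nat \<Rightarrow> 'a set) \<Rightarrow> (nat \<Rightarrow> 'a) multiset \<Rightarrow> nat set \<Rightarrow> (nat \<Rightarrow> 'a) \<Rightarrow> real" where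
  "f_loc i c D S j = - real (card (distinct_ext i D S j)) * ln (real (card (c i)))"

definition f_tot ::
  "nat \<Rightarrow> (nat \<Rightarrow> 'a set) \<Rightarrow> (nat \<Rightarrow> 'a) multiset \<Rightarrow> nat set \<Rightarrow> real" where
  "f_tot i c D S = (\<Sum>j\<in>distinct_data D S. f_loc i c D S j)"

text \<open>The counts of the states of \<open>i\<close>, with repetition and zero counts included, listed in
  non-increasing order. The list has length \<open>card (c i)\<close>; \<open>nth_count\<close> indexes it from 1.\<close>

definition sorted_counts ::
  "nat \<Rightarrow> (nat \<Rightarrow> 'a set) \<Rightarrow> (nat \<Rightarrow> 'a) multiset \<Rightarrow> nat set \<Rightarrow> (nat \<Rightarrow> 'a) \<Rightarrow> nat list" where
  "sorted_counts i c D S j =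
     rev (sorted_list_of_multiset (image_mset (n_fam i D S j) (mset_set (c i))))"

definition nth_count ::
  "nat \<Rightarrow> (nat \<Rightarrow> 'a set) \<Rightarrow> (nat \<Rightarrow> 'a) multiset \<Rightarrow> nat set \<Rightarrow> (nat \<Rightarrow> 'a) \<Rightarrow> nat \<Rightarrow> nat" where
  "nth_count i c D S j l = sorted_counts i c D S j ! (l - 1)"

text \<open>The index \<open>k'\<close>. It is only meaningful if \<open>j\<close> occurs in the data, since otherwise all counts
  vanish and the maximum is over the empty set.\<close>

definition last_pos ::
  "nat \<Rightarrow> (nat \<Rightarrow> 'a set) \<Rightarrow> (nat \<Rightarrow> 'a) multiset \<Rightarrow> nat set \<Rightarrow> (nat \<Rightarrow> 'a) \<Rightarrow> nat" where
  "last_pos i c D S j = Max {l \<in> {1..card (c i)}. nth_count i c D S j l > 0}"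

definition g_loc ::
  "nat \<Rightarrow> (nat \<Rightarrow> 'a set) \<Rightarrow> (nat \<Rightarrow> 'a) multiset \<Rightarrow> nat set \<Rightarrow> (nat \<Rightarrow> 'a) \<Rightarrow> real \<Rightarrow> real" where
  "g_loc i c D S j b =
     - (\<Sum>l = 1..last_pos i c D S j - 1. ln (1 + real (nth_count i c D S j l) / b))"

text \<open>The two lower-bar quantities: \<open>g_min\<close> has arguments \<open>S\<close> and \<open>j\<^sub>S\<close>, \<open>g_bound\<close> has
  argument \<open>S\<close> only and includes the term \<open>f_tot\<close>.\<close>

definition g_min ::
  "nat set \<Rightarrow> nat \<Rightarrow> (nat \<Rightarrow> 'a set) \<Rightarrow> (nat \<Rightarrow> 'a) multiset \<Rightarrow> real \<Rightarrow> nat set \<Rightarrow> (nat \<Rightarrow> 'a) \<Rightarrow> real" where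
  "g_min V i c D a S jS =
     Min ((\<lambda>j. g_loc i c D (V - {i}) j (a / real (q c S)))
            ` {j \<in> distinct_data D (V - {i}). restrict j S = jS})"

definition g_bound ::
  "nat set \<Rightarrow> nat \<Rightarrow> (nat \<Rightarrow> 'a set) \<Rightarrow> (nat \<Rightarrow> 'a) multiset \<Rightarrow> real \<Rightarrow> nat set \<Rightarrow> real" where
  "g_bound V i c D a S = f_tot i c D S + (\<Sum>jS\<in>distinct_data D S. g_min V i c D a S jS)"

end

theory Submission
  imports Defs
begin

text \<open>
  By exchangeability, \<open>exp (LLBDeu S j)\<close> is the probability that a Polya urn with weights
  \<open>\<alpha>\<^sub>j\<^sub>,\<^sub>k = \<alpha>\<^sub>j / q(i)\<close> produces the observations compatible with \<open>j\<close> in any prescribed order.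
  Draw them state by state. The first draw of a state after \<open>t\<close> earlier draws has probability
  \<open>(1 / q(i)) / (1 + t / \<alpha>\<^sub>j)\<close> and all other draws have probability at most 1. If the states
  are arranged by decreasing counts of a full parent configuration extending \<open>j\<close>, then \<open>t\<close> is at
  least the count of the preceding state, which gives \<open>f + g\<close>. The second part follows because
  the bound decreases when \<open>S\<close> grows.
\<close>

section \<open>Projections of the data and counts of observations\<close>

lemma distinct_data_eq: "distinct_data D S = (\<lambda>x. restrict x S) ` set_mset D"
  by (simp add: distinct_data_def proj_data_def)

lemma finite_distinct_data [simp]: "finite (distinct_data D S)"
  by (simp add: distinct_data_eq)

lemma restrict_restrict_subset: "S \<subseteq> T \<Longrightarrow> restrict (restrict x T) S = restrict x S"
  by (simp add: Int_absorb1)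

lemma restrict_distinct_data:
  assumes "S \<subseteq> T" "j \<in> distinct_data D T"
  shows "restrict j S \<in> distinct_data D S"
  using assms by (auto simp: distinct_data_eq restrict_restrict_subset simp del: restrict_restrict)

lemma distinct_data_mono_image:
  assumes "S \<subseteq> T"
  shows "distinct_data D S = (\<lambda>x. restrict x S) ` distinct_data D T"
  using assms
  by (simp add: distinct_data_eq image_image restrict_restrict_subset del: restrict_restrict)

lemma n_fam_eq: "n_fam i D S j k = size {#x \<in># D. restrict x S = j \<and> x i = k#}"
  unfolding n_fam_def proj_data_def
  by (simp add: filter_mset_image_mset restrict_restrict_subset[of S "insert i S"]
        subset_insertI del: restrict_restrict)

lemma n_par_eq: "n_par D S j = size {#x \<in># D. restrict x S = j#}"
  unfolding n_par_def proj_data_def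
  by (induction D) auto

lemma n_par_eq_sum_n_fam:
  assumes "finite A" "\<And>x. x \<in># D \<Longrightarrow> x i \<in> A"
  shows "n_par D S j = (\<Sum>k\<in>A. n_fam i D S j k)"
  using assms(2) unfolding n_par_eq n_fam_eq
proof (induction D)
  case (add x D)
  have "(\<Sum>k\<in>A. size {#y \<in># add_mset x D. restrict y S = j \<and> y i = k#}) =
        (\<Sum>k\<in>A. (if x i = k then if restrict x S = j then 1 else 0 else 0)
           + size {#y \<in># D. restrict y S = j \<and> y i = k#})"
    by (intro sum.cong) auto
  also have "\<dots> = (if restrict x S = j then 1 else 0)
           + (\<Sum>k\<in>A. size {#y \<in># D. restrict y S = j \<and> y i = k#})"
    using add.prems[of x] assms(1) by (simp add: sum.distrib)
  finally have rhs: "(\<Sum>k\<in>A. size {#y \<in># add_mset x D. restrict y S = j \<and> y i = k#}) = \<dots>" .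
  have lhs: "size {#y \<in># add_mset x D. restrict y S = j#}
      = (if restrict x S = j then 1 else 0) + size {#y \<in># D. restrict y S = j#}"
    by simp
  have IH: "size {#y \<in># D. restrict y S = j#} = (\<Sum>k\<in>A. size {#y \<in># D. restrict y S = j \<and> y i = k#})"
    by (rule add.IH) (use add.prems in auto)
  show ?case
    unfolding lhs rhs IH ..
qed simp

lemma n_fam_pos_iff: "n_fam i D S j k > 0 \<longleftrightarrow> (\<exists>x\<in>#D. restrict x S = j \<and> x i = k)"
  unfolding n_fam_eq by (auto simp: nonempty_has_size[symmetric] filter_mset_eq_mempty_iff)

text \<open>Observations matching \<open>j\<close> on \<open>T\<close> also match its projection on
  \<open>S\<close>. This brings the counts of a full configuration into the bound for
  \<open>S\<close>.\<close>

lemma n_fam_le_restrict: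
  assumes "S \<subseteq> T"
  shows "n_fam i D T j k \<le> n_fam i D S (restrict j S) k"
  unfolding n_fam_eq
  by (intro size_mset_mono filter_mset_mono_strong)
     (auto simp: restrict_restrict_subset[OF assms] simp del: restrict_restrict)

text \<open>Elements of \<open>distinct_ext i D S j\<close> equal \<open>j\<close> on
  \<open>S\<close> and are \<open>undefined\<close> outside \<open>S \<union> {i}\<close>, so their
  value at \<open>i\<close> determines them. Hence \<open>f_loc\<close> has one factor per observed
  state, that is, per first draw in the urn.\<close>

lemma card_distinct_ext:
  assumes "\<And>x. x \<in># D \<Longrightarrow> x i \<in> A"
  shows "card (distinct_ext i D S j) = card {k \<in> A. n_fam i D S j k > 0}"
proof (rule bij_betw_same_card[of "\<lambda>x. x i"])
  have r: "restrict (restrict x (S \<union> {i})) S = restrict x S" for x :: "nat \<Rightarrow> 'a"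
    by (intro restrict_restrict_subset) auto
  have "inj_on (\<lambda>x. x i) (distinct_ext i D S j)"
  proof (rule inj_onI)
    fix x y assume x: "x \<in> distinct_ext i D S j" and y: "y \<in> distinct_ext i D S j"
      and xy: "x i = y i"
    have "x v = y v" for v
    proof (cases "v \<in> S \<union> {i}")
      case True
      have "restrict x S = restrict y S"
        using x y by (simp add: distinct_ext_def)
      then show ?thesis
        using True xy by (metis Un_iff restrict_apply' singletonD)
    next
      case False
      then show ?thesis
        using x y by (auto simp: distinct_ext_def distinct_data_eq)
    qed
    then show "x = y" ..
  qed
  moreover have "(\<lambda>x. x i) ` distinct_ext i D S j = {k \<in> A. n_fam i D S j k > 0}"
    (is "?L = ?R")
  proof
    show "?L \<subseteq> ?R"
      using assms r by (auto simp: distinct_ext_def distinct_data_eq n_fam_pos_iff)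
    show "?R \<subseteq> ?L"
    proof
      fix k assume "k \<in> ?R"
      then obtain x where x: "x \<in># D" "restrict x S = j" "x i = k"
        by (auto simp: n_fam_pos_iff)
      then have "restrict x (S \<union> {i}) \<in> distinct_ext i D S j"
        using r[of x] by (simp add: distinct_ext_def distinct_data_eq del: restrict_restrict)
      then show "k \<in> ?L"
        using x by (intro image_eqI[of _ _ "restrict x (S \<union> {i})"]) auto
    qed
  qed
  ultimately show "bij_betw (\<lambda>x. x i) (distinct_ext i D S j) {k \<in> A. n_fam i D S j k > 0}"
    by (simp add: bij_betw_def)
qed

section \<open>Gamma ratios as rising factorials and the urn inequality\<close>

lemma ln_Gamma_ratio:
  assumes "b > 0"
  shows "ln (Gamma_ratio b (real m)) = ln (pochhammer b m)"
proof -
  have "b \<notin> \<int>\<^sub>\<le>\<^sub>0"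
    using assms by (auto elim!: nonpos_Ints_cases)
  then show ?thesis
    by (simp add: Gamma_ratio_def pochhammer_Gamma add.commute)
qed

lemma pochhammer_mono_real:
  fixes x y :: real
  assumes "0 < x" "x \<le> y"
  shows "pochhammer x m \<le> pochhammer y m"
  using assms unfolding pochhammer_prod by (intro prod_mono) auto

text \<open>The first factors give \<open>x / y\<close>; each later quotient
  \<open>(x + l) / (y + l)\<close> is at most 1 because \<open>x \<le> y\<close>.\<close>

lemma pochhammer_Suc_ratio_le:
  fixes x y :: real
  assumes "0 < x" "x \<le> y"
  shows "ln (pochhammer x (Suc m)) - ln (pochhammer y (Suc m)) \<le> ln (x / y)"
proof -
  have pos: "pochhammer (x + 1) m > 0" "pochhammer (y + 1) m > 0"
    using assms by (auto intro!: pochhammer_pos)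
  moreover have "pochhammer (x + 1) m \<le> pochhammer (y + 1) m"
    using assms by (intro pochhammer_mono_real) auto
  ultimately have "ln (pochhammer (x + 1) m) \<le> ln (pochhammer (y + 1) m)"
    by simp
  moreover have "ln (pochhammer z (Suc m)) = ln z + ln (pochhammer (z + 1) m)"
    if "z > 0" "pochhammer (z + 1) m > 0" for z :: real
    using that by (simp add: pochhammer_rec ln_mult)
  ultimately show ?thesis
    using assms pos by (simp add: ln_div)
qed

text \<open>Induction over the states in the order of drawing, with \<open>x\<close> as the weight
  of a state and \<open>y\<close> as the initial total weight. Only the first draw of each occurring
  state is kept.\<close>

lemma sum_ln_pochhammer_le:
  fixes x y :: real and N :: "nat \<Rightarrow> nat"
  assumes "0 < x" "x \<le> y"
  shows "(\<Sum>p<r. ln (pochhammer x (N p))) - ln (pochhammer y (\<Sum>p<r. N p))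
         \<le> (\<Sum>p | p < r \<and> N p > 0. ln (x / (y + real (\<Sum>p'<p. N p'))))"
proof (induction r)
  case (Suc r)
  let ?t = "\<Sum>p<r. N p"
  \<comment> \<open>After \<open>?t\<close> draws the urn continues with total weight
    \<open>y + ?t\<close>.\<close>
  have split: "ln (pochhammer y (?t + N r))
      = ln (pochhammer y ?t) + ln (pochhammer (y + real ?t) (N r))"
  proof -
    have "pochhammer y ?t > 0" "pochhammer (y + real ?t) (N r) > 0"
      using assms by (auto intro!: pochhammer_pos add_pos_nonneg sum_nonneg)
    then show ?thesis
      unfolding pochhammer_product' by (simp add: ln_mult del: of_nat_sum)
  qed
  show ?case
  proof (cases "N r")
    case 0
    then have "{p. p < Suc r \<and> N p > 0} = {p. p < r \<and> N p > 0}"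
      by (auto simp: less_Suc_eq)
    then show ?thesis
      using Suc 0 by simp
  next
    case (Suc m)
    then have "{p. p < Suc r \<and> N p > 0} = insert r {p. p < r \<and> N p > 0}"
      by (auto simp: less_Suc_eq)
    moreover have "ln (pochhammer x (N r)) - ln (pochhammer (y + real ?t) (N r))
        \<le> ln (x / (y + real ?t))"
      unfolding Suc
      by (intro pochhammer_Suc_ratio_le add_increasing2 of_nat_0_le_iff assms)
    ultimately show ?thesis
      using Suc.IH split by simp
  qed
qed simp

section \<open>The local bound for one extension of the parent configuration\<close>

text \<open>The sorted list forgets which state a count belongs to. The enumeration
  \<open>ks\<close> restores this, so that counts for another parent set can be read in the same
  order.\<close>

lemma sorted_counts_obtain:
  assumes "finite (c i)"
  obtains ks where "distinct ks" "set ks = c i" "length ks = card (c i)"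
    "sorted_counts i c D S j = map (n_fam i D S j) ks"
    "sorted (rev (map (n_fam i D S j) ks))"
proof -
  let ?m = "n_fam i D S j"
  obtain xs where xs: "set xs = c i" "distinct xs"
    using finite_distinct_list[OF assms] by auto
  define ks where "ks = rev (sort_key ?m xs)"
  have dist: "distinct ks" "set ks = c i"
    using xs by (auto simp: ks_def)
  have "image_mset ?m (mset_set (c i)) = mset (map ?m (sort_key ?m xs))"
    using xs by (simp flip: mset_set_set)
  then have eq: "sorted_counts i c D S j = map ?m ks"
    unfolding sorted_counts_def ks_def
    by (simp only: sorted_list_of_multiset_mset rev_map sorted_sort_id sorted_sort_key)
  have "sorted (rev (map ?m ks))"
    by (simp add: ks_def rev_map)
  then show ?thesis
    using that dist eq distinct_card[OF dist(1)] by metis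
qed

text \<open>The states are drawn in the order of their counts at \<open>T\<close>, but as often as
  they are counted at \<open>S\<close>. Since \<open>j\<close> is arbitrary, a minimiser can be
  inserted later.\<close>

lemma LLBDeu_le_f_loc_g_loc:
  assumes fin: "finite (c i)" and D: "\<And>x. x \<in># D \<Longrightarrow> x i \<in> c i"
    and pos: "a > 0" "q c S > 0" and ST: "S \<subseteq> T" and j: "j \<in> distinct_data D T"
  shows "LLBDeu i c D a S (restrict j S)
         \<le> f_loc i c D S (restrict j S) + g_loc i c D T j (a / real (q c S))"
proof -
  let ?jS = "restrict j S" and ?r = "card (c i)"
  \<comment> \<open>\<open>y\<close> is \<open>alpha_par\<close> and \<open>x\<close> is
    \<open>alpha_fam\<close>: the total weight and the weight per state.\<close>
  define y where "y = a / real (q c S)"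
  define x where "x = y / real ?r"
  let ?m = "n_fam i D T j"
  obtain ks where ks: "distinct ks" "set ks = c i" "length ks = ?r"
    and eq: "sorted_counts i c D T j = map ?m ks"
    and sorted: "sorted (rev (map ?m ks))"
    by (rule sorted_counts_obtain[of c i D T j, OF fin])
  have dec: "?m (ks ! p') \<le> ?m (ks ! p)" if "p \<le> p'" "p' < ?r" for p p'
    using sorted_rev_nth_mono[OF sorted that(1)] that ks(3) by simp
  \<comment> \<open>Positions \<open>p\<close> start at 0. \<open>N\<close> uses the order of the
    counts at \<open>T\<close> and need not decrease; \<open>t p\<close> is the number of draws
    before the state in position \<open>p\<close>.\<close>
  define N where "N p = n_fam i D S ?jS (ks ! p)" for p
  define t where "t p = (\<Sum>p'<p. N p')" for p
  have mN: "?m (ks ! p) \<le> N p" for p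
    unfolding N_def using ST by (rule n_fam_le_restrict)
  have bij: "bij_betw (\<lambda>p. ks ! p) {..<?r} (c i)"
    using bij_betw_nth[OF ks(1) refl refl] ks by simp
  \<comment> \<open>The observation \<open>z\<close> makes \<open>c i\<close> nonempty and gives a
    positive count at \<open>T\<close>, so that the \<open>Max\<close> in \<open>last_pos\<close> is
    over a nonempty set.\<close>
  obtain z where z: "z \<in># D" "restrict z T = j"
    using j by (auto simp: distinct_data_eq)
  have r: "?r > 0"
    using fin D[OF z(1)] card_gt_0_iff by blast
  have xy: "0 < y" "0 < x" "x \<le> y"
  proof -
    show y: "0 < y"
      using pos by (simp add: y_def)
    then show "0 < x"
      using r by (simp add: x_def)
    have "y / real ?r \<le> y / 1"
      using y r by (intro divide_left_mono) auto
    then show "x \<le> y"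
      by (simp add: x_def)
  qed

  define K where "K = last_pos i c D T j"
  let ?L = "{l \<in> {1..?r}. nth_count i c D T j l > 0}"
  have "K \<in> ?L"
  proof -
    obtain p where p: "p < ?r" "ks ! p = z i"
      using D[OF z(1)] ks by (metis in_set_conv_nth)
    then have "?m (ks ! p) > 0"
      using z by (auto simp: n_fam_pos_iff)
    then have "Suc p \<in> ?L"
      using p ks by (simp add: nth_count_def eq)
    then have "?L \<noteq> {}" by blast
    then show ?thesis
      unfolding K_def last_pos_def by (intro Max_in) auto
  qed
  then have K: "1 \<le> K" "K \<le> ?r" "?m (ks ! (K - 1)) > 0"
    using ks by (auto simp: nth_count_def eq)

  \<comment> \<open>\<open>nth_count\<close> starts at 1, so the \<open>l\<close>-th largest count
    sits in position \<open>l - 1\<close> of \<open>ks\<close>. This state is drawn before the one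
    in position \<open>l\<close>, hence its count is part of \<open>t l\<close>.\<close>
  have g: "(\<Sum>l = 1..K - 1. ln (1 + real (nth_count i c D T j l) / y))
      \<le> (\<Sum>p | p < ?r \<and> N p > 0. ln (1 + real (t p) / y))"
  proof -
    have "(\<Sum>l = 1..K - 1. ln (1 + real (nth_count i c D T j l) / y))
        \<le> (\<Sum>l = 1..K - 1. ln (1 + real (t l) / y))"
    proof (rule sum_mono)
      fix l assume l: "l \<in> {1..K - 1}"
      then have "l - 1 < length ks"
        using K ks(3) by auto
      then have "nth_count i c D T j l = ?m (ks ! (l - 1))"
        by (simp add: nth_count_def eq)
      also have "\<dots> \<le> N (l - 1)"
        by (rule mN)
      also have "\<dots> \<le> t l"
        unfolding t_def using l by (intro member_le_sum) auto
      finally have "real (nth_count i c D T j l) / y \<le> real (t l) / y"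
        using xy by (intro divide_right_mono) auto
      then show "ln (1 + real (nth_count i c D T j l) / y) \<le> ln (1 + real (t l) / y)"
        using xy by (intro ln_mono) (auto intro: add_pos_nonneg)
    qed
    \<comment> \<open>The additional summands are nonnegative: position 0, where
      \<open>t 0 = 0\<close>, and positions from \<open>K\<close> on whose states occur at
      \<open>S\<close>.\<close>
    also have "\<dots> \<le> (\<Sum>p | p < ?r \<and> N p > 0. ln (1 + real (t p) / y))"
    proof (rule sum_mono2)
      show "{1..K - 1} \<subseteq> {p. p < ?r \<and> N p > 0}"
      proof
        fix l assume l: "l \<in> {1..K - 1}"
        then have "?m (ks ! (K - 1)) \<le> ?m (ks ! l)"
          using K ks by (intro dec) auto
        then show "l \<in> {p. p < ?r \<and> N p > 0}"
          using l K mN[of l] by auto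
      qed
    qed (use xy in auto)
    finally show ?thesis .
  qed

  have card: "card (distinct_ext i D S ?jS) = card {p. p < ?r \<and> N p > 0}"
  proof -
    have "bij_betw (\<lambda>p. ks ! p) {p \<in> {..<?r}. N p > 0} {k \<in> c i. n_fam i D S ?jS k > 0}"
      by (rule bij_betw_Collect[OF bij]) (simp add: N_def)
    moreover have "card (distinct_ext i D S ?jS) = card {k \<in> c i. n_fam i D S ?jS k > 0}"
      by (rule card_distinct_ext) (erule D)
    ultimately show ?thesis
      by (simp add: bij_betw_same_card)
  qed

  have n_par: "n_par D S ?jS = (\<Sum>k\<in>c i. n_fam i D S ?jS k)"
    by (rule n_par_eq_sum_n_fam) (fact fin | erule D)+
  have "LLBDeu i c D a S ?jS
      = (\<Sum>k\<in>c i. ln (pochhammer x (n_fam i D S ?jS k))) - ln (pochhammer y (n_par D S ?jS))"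
    using xy by (simp add: LLBDeu_def alpha_par_def alpha_fam_def ln_Gamma_ratio x_def y_def)
  also have "\<dots> = (\<Sum>p<?r. ln (pochhammer x (N p))) - ln (pochhammer y (\<Sum>p<?r. N p))"
    using sum.reindex_bij_betw[OF bij, of "n_fam i D S ?jS"]
      sum.reindex_bij_betw[OF bij, of "\<lambda>k. ln (pochhammer x (n_fam i D S ?jS k))"]
    by (simp add: N_def n_par)
  also have "\<dots> \<le> (\<Sum>p | p < ?r \<and> N p > 0. ln (x / (y + real (t p))))"
    unfolding t_def by (rule sum_ln_pochhammer_le) (use xy in auto)
  \<comment> \<open>Each factor splits into \<open>1 / ?r\<close> and
    \<open>1 / (1 + t p / y)\<close>. The former add up to \<open>f_loc\<close>, the latter are
    compared with \<open>g_loc\<close> by \<open>g\<close>.\<close>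
  also have "\<dots> = (\<Sum>p | p < ?r \<and> N p > 0. - ln (real ?r) - ln (1 + real (t p) / y))"
  proof (rule sum.cong)
    fix p
    have "x / (y + real (t p)) = 1 / (real ?r * (1 + real (t p) / y))"
      using xy r by (simp add: x_def field_simps)
    moreover have "1 + real (t p) / y > 0"
      using xy by (intro add_pos_nonneg) auto
    ultimately show "ln (x / (y + real (t p))) = - ln (real ?r) - ln (1 + real (t p) / y)"
      using r by (simp add: ln_div ln_mult)
  qed simp
  also have "\<dots> = f_loc i c D S ?jS - (\<Sum>p | p < ?r \<and> N p > 0. ln (1 + real (t p) / y))"
    by (simp add: f_loc_def card sum_subtractf)
  also have "\<dots> \<le> f_loc i c D S ?jS + g_loc i c D T j y"
    using g by (simp add: g_loc_def K_def)
  finally show ?thesis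
    by (simp add: y_def)
qed

section \<open>Monotonicity of the bound in the parent set\<close>

lemma g_loc_nonpos: "b > 0 \<Longrightarrow> g_loc i c D S j b \<le> 0"
  by (simp add: g_loc_def sum_nonneg)

text \<open>A smaller \<open>b\<close> enlarges every logarithm. It is applied to
  \<open>b = a / q c S\<close>, which does not grow when parents are added.\<close>

lemma g_loc_mono:
  assumes "0 < b" "b \<le> b'"
  shows "g_loc i c D S j b \<le> g_loc i c D S j b'"
  unfolding g_loc_def neg_le_iff_le
proof (rule sum_mono)
  fix l
  have "real (nth_count i c D S j l) / b' \<le> real (nth_count i c D S j l) / b"
    using assms by (intro divide_left_mono) auto
  then show "ln (1 + real (nth_count i c D S j l) / b') \<le> ln (1 + real (nth_count i c D S j l) / b)"
    using assms by (intro ln_mono) (auto intro: add_pos_nonneg)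
qed

lemma q_pos_mono:
  assumes "finite T" "\<And>v. v \<in> T \<Longrightarrow> finite (c v) \<and> c v \<noteq> {}" "S \<subseteq> T"
  shows "q c S > 0" "q c S \<le> q c T"
proof -
  have fin: "finite S"
    using assms finite_subset by blast
  show "q c S > 0"
    using assms fin by (auto simp: q_def configs_def card_PiE card_gt_0_iff intro!: prod_pos)
  have "(\<Prod>v\<in>T. card (c v)) > 0"
    using assms by (auto simp: card_gt_0_iff intro!: prod_pos)
  then show "q c S \<le> q c T"
    using assms fin
    by (auto simp: q_def configs_def card_PiE intro!: dvd_imp_le prod_dvd_prod_subset)
qed

text \<open>The sets \<open>distinct_ext i D S j\<close> are the fibres of the projection onto
  \<open>S\<close> and partition the distinct data on \<open>S \<union> {i}\<close>.\<close>

lemma f_tot_eq: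
  "f_tot i c D S = - real (card (distinct_data D (S \<union> {i}))) * ln (real (card (c i)))"
proof -
  have "(\<Sum>j\<in>distinct_data D S. card (distinct_ext i D S j))
      = (\<Sum>j\<in>distinct_data D S. \<Sum>x | x \<in> distinct_data D (S \<union> {i}) \<and> restrict x S = j. 1)"
    by (simp add: distinct_ext_def)
  also have "\<dots> = card (distinct_data D (S \<union> {i}))"
    by (subst sum.group) (auto intro: restrict_distinct_data)
  finally have "card (distinct_data D (S \<union> {i}))
      = (\<Sum>j\<in>distinct_data D S. card (distinct_ext i D S j))" ..
  then show ?thesis
    by (simp add: f_tot_def f_loc_def sum_distrib_right sum_negf)
qed

lemma f_tot_antimono:
  assumes "S \<subseteq> T" "card (c i) > 0"
  shows "f_tot i c D T \<le> f_tot i c D S"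
proof -
  have "card (distinct_data D (S \<union> {i})) \<le> card (distinct_data D (T \<union> {i}))"
    unfolding distinct_data_mono_image[of "S \<union> {i}" "T \<union> {i}" D, OF Un_mono[OF assms(1) order_refl]]
    by (intro card_image_le) simp
  then show ?thesis
    using assms by (simp add: f_tot_eq mult_right_mono)
qed

text \<open>\<open>jS\<close> is the projection of an observation, hence of a full configuration in
  the data, so the minimum is over a nonempty finite set and is attained.\<close>

lemma g_min_obtain:
  assumes "S \<subseteq> V - {i}" "jS \<in> distinct_data D S"
  obtains j where "j \<in> distinct_data D (V - {i})" "restrict j S = jS"
    "g_min V i c D a S jS = g_loc i c D (V - {i}) j (a / real (q c S))"
proof -
  have "jS \<in> (\<lambda>j. restrict j S) ` distinct_data D (V - {i})"
    using assms distinct_data_mono_image by metis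
  then have "{j \<in> distinct_data D (V - {i}). restrict j S = jS} \<noteq> {}"
    by blast
  then have "g_min V i c D a S jS \<in> (\<lambda>j. g_loc i c D (V - {i}) j (a / real (q c S)))
      ` {j \<in> distinct_data D (V - {i}). restrict j S = jS}"
    unfolding g_min_def by (intro Min_in) auto
  then show ?thesis
    using that by auto
qed

lemma g_min_le:
  assumes "j \<in> distinct_data D (V - {i})"
  shows "g_min V i c D a S (restrict j S) \<le> g_loc i c D (V - {i}) j (a / real (q c S))"
  unfolding g_min_def using assms by (intro Min_le) auto

text \<open>The terms for \<open>T\<close> are grouped by their projection onto \<open>S\<close>.
  All are nonpositive, so in each group it suffices to keep the one below the minimiser for
  \<open>jS\<close>.\<close>

lemma sum_g_min_antimono:
  assumes "S \<subseteq> T" "T \<subseteq> V - {i}" "a > 0" "q c S > 0" "q c S \<le> q c T"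
  shows "(\<Sum>jT\<in>distinct_data D T. g_min V i c D a T jT)
         \<le> (\<Sum>jS\<in>distinct_data D S. g_min V i c D a S jS)"
proof -
  let ?g = "g_min V i c D a T"
  let ?fib = "\<lambda>jS. {jT \<in> distinct_data D T. restrict jT S = jS}"
  have b: "0 < a / real (q c T)" "a / real (q c T) \<le> a / real (q c S)"
    using assms by (auto intro!: divide_left_mono)
  have nonpos: "?g jT \<le> 0" if "jT \<in> distinct_data D T" for jT
    using g_min_obtain[OF assms(2) that] g_loc_nonpos[OF b(1)] by metis
  have "(\<Sum>jT\<in>distinct_data D T. ?g jT) = (\<Sum>jS\<in>distinct_data D S. sum ?g (?fib jS))"
    using assms(1) by (subst sum.group) (auto intro: restrict_distinct_data)
  also have "\<dots> \<le> (\<Sum>jS\<in>distinct_data D S. g_min V i c D a S jS)"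
  proof (rule sum_mono)
    fix jS assume "jS \<in> distinct_data D S"
    then obtain j where j: "j \<in> distinct_data D (V - {i})" "restrict j S = jS"
      and eq: "g_min V i c D a S jS = g_loc i c D (V - {i}) j (a / real (q c S))"
      using g_min_obtain[of S V i] assms by (metis subset_trans)
    have mem: "restrict j T \<in> ?fib jS"
      using j assms(1,2)
      by (simp add: restrict_distinct_data restrict_restrict_subset del: restrict_restrict)
    have "sum ?g (?fib jS) = ?g (restrict j T) + sum ?g (?fib jS - {restrict j T})"
      using mem by (intro sum.remove) auto
    also have "\<dots> \<le> ?g (restrict j T)"
      using sum_nonpos[of "?fib jS - {restrict j T}" ?g] nonpos by simp
    also have "\<dots> \<le> g_loc i c D (V - {i}) j (a / real (q c T))"
      using j(1) by (rule g_min_le)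
    also have "\<dots> \<le> g_min V i c D a S jS"
      unfolding eq using b by (rule g_loc_mono)
    finally show "sum ?g (?fib jS) \<le> g_min V i c D a S jS" .
  qed
  finally show ?thesis .
qed

section \<open>The bound at a minimiser and the pruning of supersets\<close>

theorem theorem2:
  fixes n i :: nat and V :: "nat set" and c :: "nat \<Rightarrow> 'a set"
    and D :: "(nat \<Rightarrow> 'a) multiset" and alpha_ess :: real and S :: "nat set"
  assumes "V = {1..n}" and "i \<in> V"
    and "\<forall>v\<in>V. finite (c v) \<and> c v \<noteq> {}"
    and "set_mset D \<subseteq> configs c V"
    and "alpha_ess > 0"
    and "S \<subseteq> V - {i}"
  shows "(\<forall>jS\<in>distinct_data D S.
            LLBDeu i c D alpha_ess S jS \<le> f_loc i c D S jS + g_min V i c D alpha_ess S jS) \<and>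
         ((\<exists>S'. S' \<subset> S \<and> LBDeu i c D alpha_ess S' \<ge> g_bound V i c D alpha_ess S) \<longrightarrow>
          (\<forall>T. S \<subseteq> T \<and> T \<subseteq> V - {i} \<longrightarrow> T \<notin> candidate_parents V i c D alpha_ess))"
proof -
  have state: "finite (c v) \<and> c v \<noteq> {}" if "v \<in> V" for v
    using assms(3) that by blast
  have ci: "finite (c i)" "card (c i) > 0"
    using state[OF assms(2)] by (auto simp: card_gt_0_iff)
  have D: "x i \<in> c i" if "x \<in># D" for x
    using assms(2,4) that by (auto simp: configs_def)
  have q: "q c S' > 0" "q c S' \<le> q c T'" if "S' \<subseteq> T'" "T' \<subseteq> V - {i}" for S' T'
  proof -
    have T': "T' \<subseteq> V" "finite T'"
      using that assms(1) by (auto intro: finite_subset[of T' V])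
    show "q c S' > 0" "q c S' \<le> q c T'"
      by (rule q_pos_mono[OF T'(2) _ that(1)]; use state T'(1) in blast)+
  qed
  \<comment> \<open>Stated for every \<open>T\<close> because the pruning claim needs it for all
    supersets of \<open>S\<close>. Taking \<open>j\<close> as a minimiser turns \<open>g_loc\<close>
    into \<open>g_min\<close>.\<close>
  have local: "LLBDeu i c D alpha_ess T jT \<le> f_loc i c D T jT + g_min V i c D alpha_ess T jT"
    if T: "T \<subseteq> V - {i}" and jT: "jT \<in> distinct_data D T" for T jT
  proof -
    obtain j where j: "j \<in> distinct_data D (V - {i})" "restrict j T = jT"
      "g_min V i c D alpha_ess T jT = g_loc i c D (V - {i}) j (alpha_ess / real (q c T))"
      using g_min_obtain[OF T jT] .
    have "LLBDeu i c D alpha_ess T (restrict j T) \<le> f_loc i c D T (restrict j T)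
        + g_loc i c D (V - {i}) j (alpha_ess / real (q c T))"
      by (rule LLBDeu_le_f_loc_g_loc)
         (fact ci(1) assms(5) q(1)[OF order_refl T] T j(1) | erule D)+
    then show ?thesis
      by (simp only: j(2,3))
  qed
  \<comment> \<open>The local bounds sum to \<open>g_bound\<close> at \<open>T\<close>, and neither
    of its two parts increases from \<open>S\<close> to \<open>T\<close>.\<close>
  have total: "LBDeu i c D alpha_ess T \<le> g_bound V i c D alpha_ess S"
    if T: "S \<subseteq> T" "T \<subseteq> V - {i}" for T
  proof -
    have "LBDeu i c D alpha_ess T \<le> g_bound V i c D alpha_ess T"
      unfolding LBDeu_def g_bound_def f_tot_def sum.distrib[symmetric]
      using local[OF T(2)] by (rule sum_mono)
    also have "\<dots> \<le> g_bound V i c D alpha_ess S"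
      unfolding g_bound_def
      using f_tot_antimono[where c = c and i = i, OF T(1) ci(2)]
        sum_g_min_antimono[OF T assms(5)] q[OF T]
      by (intro add_mono) auto
    finally show ?thesis .
  qed
  show ?thesis
  proof (intro conjI ballI impI allI)
    show "LLBDeu i c D alpha_ess S jS \<le> f_loc i c D S jS + g_min V i c D alpha_ess S jS"
      if "jS \<in> distinct_data D S" for jS
      using local[OF assms(6) that] .
  next
    fix T
    assume "\<exists>S'. S' \<subset> S \<and> g_bound V i c D alpha_ess S \<le> LBDeu i c D alpha_ess S'"
      and T: "S \<subseteq> T \<and> T \<subseteq> V - {i}"
    then obtain S' where S': "S' \<subset> S" "g_bound V i c D alpha_ess S \<le> LBDeu i c D alpha_ess S'"
      by blast
    \<comment> \<open>\<open>S'\<close> itself witnesses the failure of strict improvement at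
      \<open>T\<close>: the score of \<open>T\<close> is at most \<open>g_bound\<close> at
      \<open>S\<close>, hence at most the score of \<open>S'\<close>.\<close>
    have "S' \<subset> T"
      using S'(1) T by blast
    moreover have "\<not> LBDeu i c D alpha_ess S' < LBDeu i c D alpha_ess T"
      using total[of T] T S'(2) by linarith
    ultimately show "T \<notin> candidate_parents V i c D alpha_ess"
      unfolding candidate_parents_def by blast
  qed
qed

end
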